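(* Let $\sigma>0$, $0<k<1$, and let $\varphi(t)=\mathbb{E}[e^{itX}]$ be the characteristic function of $X\sim\mathrm{LN}(0,\sigma^2)$. Then the formula $$\varphi(t)=\frac{1}{2\pi}\int_{k-i\infty}^{k+i\infty}\sin(\pi s)\,\Gamma(s)\,e^{-\left(\ln t+i\frac{\pi}{2}\right)s+\frac{\sigma^2}{2}s^2}\,ds\qquad\text{for all }t>0$$ is incorrect; that is, there exists $t>0$ for which the two sides differ.
   Context: $X\sim\mathrm{LN}(0,\sigma^2)$ (lognormal) means that $X$ is a positive random variable with density $f(x)=\frac{1}{\sqrt{2\pi}\,\sigma x}\exp\left[-\frac{(\ln x)^2}{2\sigma^2}\right]$, $x>0$. $\Gamma$ is the gamma function. The contour of integration is the vertical line $\operatorname{Re}(s)=k$, traversed upward. *)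

theory Defs
  imports "HOL-Probability.Probability" "HOL-Complex_Analysis.Complex_Analysis"
begin

text \<open>
  The density of \<open>LN(0, \<sigma>\<^sup>2)\<close>. Vanishing on \<open>x \<le> 0\<close> forces a random variable with this
  density to be positive almost surely.
\<close>

definition lognormal_density :: "real \<Rightarrow> real \<Rightarrow> real" where
  "lognormal_density \<sigma> x =
     (if x > 0 then 1 / (sqrt (2 * pi) * \<sigma> * x) * exp (- (ln x)\<^sup>2 / (2 * \<sigma>\<^sup>2)) else 0)"

text \<open>
  Integrals along the line \<open>Re s = k\<close>, traversed upward: the parametrization \<open>s = k + \<i> y\<close>
  gives \<open>ds = \<i> dy\<close>. The integral takes a default value for functions that are not
  absolutely integrable along the line, hence the separate integrability predicate.
\<close>

definition vertical_line_integrable :: "real \<Rightarrow> (complex \<Rightarrow> complex) \<Rightarrow> bool" where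
  "vertical_line_integrable k f \<longleftrightarrow> integrable lborel (\<lambda>y. f (Complex k y))"

definition vertical_line_integral :: "real \<Rightarrow> (complex \<Rightarrow> complex) \<Rightarrow> complex" where
  "vertical_line_integral k f = (LINT y|lborel. f (Complex k y) * \<i>)"

definition claimed_integrand :: "real \<Rightarrow> real \<Rightarrow> complex \<Rightarrow> complex" where
  "claimed_integrand \<sigma> t s =
     sin (of_real pi * s) * Gamma s *
     exp (- (of_real (ln t) + \<i> * of_real pi / 2) * s + of_real (\<sigma>\<^sup>2) / 2 * s\<^sup>2)"

end

theory Submission imports Defs "HOL-Real_Asymp.Real_Asymp" begin

(* Since sin (pi s) * Gamma s = pi / Gamma (1 - s), the integrand extends to an entire function with
   Gaussian decay along vertical lines, so the contour can be moved to Re s = k - 1 < 0. There the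
   integral is O(t powr (1 - k)), hence tends to 0 as t -> 0+, whereas a characteristic function
   tends to 1. *)

text \<open>The triangle inequality for Euler's integral, since \<open>t powr (z - 1)\<close> has
  modulus \<open>t powr (Re z - 1)\<close> for real \<open>t \<ge> 0\<close>. It bounds Gamma on a
  vertical line independently of the imaginary part.\<close>

lemma norm_Gamma_le_Gamma_Re:
  assumes "Re z > 0"
  shows "norm (Gamma z) \<le> Gamma (Re z)"
proof -
  let ?f = "\<lambda>t. of_real t powr (z - 1) / complex_of_real (exp t)"
  let ?g = "\<lambda>t. t powr (Re z - 1) / exp t"
  have f: "(?f has_integral Gamma z) {0..}" and g: "(?g has_integral Gamma (Re z)) {0..}"
    using Gamma_integral_complex[OF assms] Gamma_integral_real[OF assms] by auto
  have "norm (integral {0..} ?f) \<le> integral {0..} ?g"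
    using f g by (intro integral_norm_bound_integral)
      (auto simp: has_integral_iff norm_divide norm_powr_real_powr)
  then show ?thesis
    using f g by (simp add: has_integral_iff)
qed

section \<open>Shifting a vertical line of integration\<close>

lemma vertical_segment_integral:
  assumes P: "\<And>s. (P has_field_derivative F s) (at s)"
    and F: "continuous_on UNIV F" and "c \<le> d"
  shows "(LINT y|lborel. indicator {c..d} y *\<^sub>R (F (Complex a y) * \<i>)) = P (Complex a d) - P (Complex a c)"
proof (rule integral_FTC_atLeastAtMost[OF \<open>c \<le> d\<close>])
  fix y assume "c \<le> y" "y \<le> d"
  have "((\<lambda>y. Complex a y) has_vector_derivative \<i>) (at y within {c..d})"
    unfolding Complex_eq
    by (auto intro!: derivative_eq_intros)
  from field_vector_diff_chain_within[OF this has_field_derivative_at_within[OF P]]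
  show "((\<lambda>y. P (Complex a y)) has_vector_derivative (F (Complex a y) * \<i>)) (at y within {c..d})"
    by (simp add: o_def mult.commute)
next
  show "continuous_on {c..d} (\<lambda>y. F (Complex a y) * \<i>)"
    unfolding Complex_eq
    by (intro continuous_intros continuous_on_compose2[OF F]) auto
qed

text \<open>Cauchy's theorem for growing rectangles, phrased through a global primitive
  \<open>P\<close>: the two vertical sides differ by the increments of \<open>P\<close> along the
  horizontal edges, which \<open>h\<close> forces to 0. Bounding \<open>F\<close> only for
  \<open>1 \<le> \<bar>y\<bar>\<close> leaves out a neighbourhood of the real axis, where the edges
  never lie in the limit.\<close>

lemma vertical_line_integral_shift:
  assumes F: "F holomorphic_on UNIV" and "a \<le> b"
    and int: "vertical_line_integrable a F" "vertical_line_integrable b F"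
    and bound: "\<And>x y. x \<in> {a..b} \<Longrightarrow> 1 \<le> \<bar>y\<bar> \<Longrightarrow> norm (F (Complex x y)) \<le> h \<bar>y\<bar>"
    and h: "(h \<longlongrightarrow> 0) at_top"
  shows "vertical_line_integral a F = vertical_line_integral b F"
proof -
  obtain P where P: "\<And>s. (P has_field_derivative F s) (at s)"
    using holomorphic_convex_primitive'[OF _ _ F] by auto
  have cont: "continuous_on UNIV F"
    using F by (rule holomorphic_on_imp_continuous_on)
  \<comment> \<open>\<open>V x n\<close> is the integral of \<open>F\<close> over the segment from
    \<open>x - \<i> n\<close> to \<open>x + \<i> n\<close>.\<close>
  define V where "V x n = P (Complex x (real n)) - P (Complex x (- real n))" for x n
  have lim: "V x \<longlonglongrightarrow> vertical_line_integral x F" if "vertical_line_integrable x F" for x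
  proof -
    have i: "integrable lborel (\<lambda>y. F (Complex x y) * \<i>)"
      using that unfolding vertical_line_integrable_def by simp
    have "(\<lambda>n. LINT y|lborel. indicator {- real n..real n} y *\<^sub>R (F (Complex x y) * \<i>))
            \<longlonglongrightarrow> (LINT y|lborel. F (Complex x y) * \<i>)"
    proof (rule integral_dominated_convergence[where w = "\<lambda>y. norm (F (Complex x y) * \<i>)"])
      show "AE y in lborel. (\<lambda>n. indicator {- real n..real n} y *\<^sub>R (F (Complex x y) * \<i>))
              \<longlonglongrightarrow> F (Complex x y) * \<i>"
      proof (intro AE_I2 tendsto_eventually)
        fix y :: real
        have "eventually (\<lambda>n. \<bar>y\<bar> \<le> real n) sequentially"
          using filterlim_real_sequentially by (auto simp: filterlim_at_top)
        then show "eventually (\<lambda>n. indicator {- real n..real n} y *\<^sub>R (F (Complex x y) * \<i>)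
                     = F (Complex x y) * \<i>) sequentially"
          by eventually_elim (auto simp: indicator_def)
      qed
    qed (use i in \<open>auto simp: indicator_def intro!: AE_I2\<close>)
    then show ?thesis
      unfolding V_def vertical_line_integral_def
      using vertical_segment_integral[OF P cont] by simp
  qed
  \<comment> \<open>Mean value inequality for \<open>P\<close> on the horizontal edge at height
    \<open>y\<close>.\<close>
  have edge: "norm (P (Complex b y) - P (Complex a y)) \<le> h \<bar>y\<bar> * (b - a)" if "1 \<le> \<bar>y\<bar>" for y
  proof -
    have "norm (P (Complex b y) - P (Complex a y)) \<le> h \<bar>y\<bar> * norm (Complex b y - Complex a y)"
    proof (rule field_differentiable_bound)
      show "convex (closed_segment (Complex a y) (Complex b y))" by simp
      fix z assume z: "z \<in> closed_segment (Complex a y) (Complex b y)"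
      show "(P has_field_derivative F z) (at z within closed_segment (Complex a y) (Complex b y))"
        using P has_field_derivative_at_within by blast
      have "closed_segment (Complex a y) (Complex b y) \<subseteq> {z. Re z \<in> {a..b} \<and> Im z = y}"
        using \<open>a \<le> b\<close> by (auto simp: closed_segment_same_Im closed_segment_eq_real_ivl)
      with z have "Re z \<in> {a..b}" "z = Complex (Re z) y"
        by (auto simp: complex_eq_iff)
      then show "norm (F z) \<le> h \<bar>y\<bar>"
        using bound that by metis
    qed auto
    also have "norm (Complex b y - Complex a y) = b - a"
      using \<open>a \<le> b\<close> by (simp add: cmod_def)
    finally show ?thesis .
  qed
  have "(\<lambda>n. V b n - V a n) \<longlonglongrightarrow> 0"
  proof (rule Lim_null_comparison)
    show "eventually (\<lambda>n. norm (V b n - V a n) \<le> 2 * (h (real n) * (b - a))) sequentially"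
      using eventually_ge_at_top[of 1]
    proof eventually_elim
      case (elim n)
      \<comment> \<open>The four corner values of \<open>P\<close> are regrouped by height: top edge
        minus bottom edge.\<close>
      have "norm (V b n - V a n) = norm ((P (Complex b (real n)) - P (Complex a (real n)))
              - (P (Complex b (- real n)) - P (Complex a (- real n))))"
        unfolding V_def by (simp add: algebra_simps)
      also have "\<dots> \<le> h (real n) * (b - a) + h (real n) * (b - a)"
        using edge[of "real n"] edge[of "- real n"] elim
        by (intro order_trans[OF norm_triangle_ineq4 add_mono]) auto
      finally show ?case by (simp add: mult.commute)
    qed
    show "(\<lambda>n. 2 * (h (real n) * (b - a))) \<longlonglongrightarrow> 0"
      by (intro tendsto_mult_right_zero tendsto_mult_left_zero
          filterlim_compose[OF h filterlim_real_sequentially])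
  qed
  moreover have "(\<lambda>n. V b n - V a n) \<longlonglongrightarrow> vertical_line_integral b F - vertical_line_integral a F"
    by (intro tendsto_diff lim int)
  ultimately show ?thesis
    using LIMSEQ_unique by fastforce
qed

section \<open>The entire extension of the integrand and its decay\<close>

definition entire_integrand :: "real \<Rightarrow> real \<Rightarrow> complex \<Rightarrow> complex" where
  "entire_integrand \<sigma> t s = of_real pi * rGamma (1 - s) *
     exp (- (of_real (ln t) + \<i> * of_real pi / 2) * s + of_real (\<sigma>\<^sup>2) / 2 * s\<^sup>2)"

text \<open>This is why \<open>rGamma\<close> replaces \<open>sin\<close> times
  \<open>Gamma\<close>: at its pole 0 \<open>Gamma\<close> has the default value 0, so
  \<open>claimed_integrand\<close> vanishes at 0, where the extension has the value pi. The shifted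
  contour crosses this point.\<close>

lemma holomorphic_entire_integrand: "entire_integrand \<sigma> t holomorphic_on A"
  unfolding entire_integrand_def by (intro holomorphic_intros) auto

text \<open>Euler's reflection formula, divided by \<open>rGamma s\<close>, whose zeros are the
  nonpositive integers.\<close>

lemma claimed_integrand_eq_entire_integrand:
  assumes "Re s > 0"
  shows "claimed_integrand \<sigma> t s = entire_integrand \<sigma> t s"
proof -
  have "s \<notin> \<int>\<^sub>\<le>\<^sub>0" using assms by (auto elim!: nonpos_Ints_cases)
  then have "rGamma s \<noteq> 0" by (simp add: rGamma_eq_zero_iff)
  then have "sin (of_real pi * s) * Gamma s = of_real pi * rGamma (1 - s)"
    using rGamma_reflection_complex[of s] by (simp add: Gamma_def field_simps)
  then show ?thesis
    by (simp add: claimed_integrand_def entire_integrand_def)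
qed

(* Gamma is evaluated at s + 1, where its real part stays positive on the whole strip. *)
lemma pi_rGamma_one_minus_eq:
  fixes s :: complex
  assumes "Re s > -1" "s \<noteq> 0"
  shows "of_real pi * rGamma (1 - s) = sin (of_real pi * s) * Gamma (s + 1) / s"
proof -
  have "s + 1 \<notin> \<int>\<^sub>\<le>\<^sub>0" using assms by (auto elim!: nonpos_Ints_cases simp: complex_eq_iff)
  then have nz: "rGamma (s + 1) \<noteq> 0" by (simp add: rGamma_eq_zero_iff)
  have "s * rGamma (s + 1) * rGamma (1 - s) = sin (of_real pi * s) / of_real pi"
    using rGamma_reflection_complex[of s] by (simp add: rGamma_plus1)
  with nz show ?thesis
    using assms by (simp add: Gamma_def field_simps)
qed

text \<open>The growth in \<open>Im s\<close> is at most exponential, so the Gaussian factor coming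
  from \<open>s\<^sup>2\<close> wins. \<open>K\<close> is chosen before \<open>t\<close>, which the
  limit in \<open>t\<close> requires; \<open>\<delta>\<close> controls the division by
  \<open>s\<close> in the formula for \<open>rGamma (1 - s)\<close>.\<close>

lemma norm_entire_integrand_le:
  assumes "\<sigma> > 0" "0 < k" "k < 1" "0 < \<delta>"
  obtains K where "0 < K"
    "\<And>t s. t > 0 \<Longrightarrow> Re s \<in> {k - 1..k} \<Longrightarrow> \<delta> \<le> norm s \<Longrightarrow>
       norm (entire_integrand \<sigma> t s) \<le> K * t powr (- Re s) * exp (- (\<sigma> * Im s)\<^sup>2 / 4)"
proof -
  \<comment> \<open>The interval is the range of \<open>Re s + 1\<close> on the strip; it stays to
    the right of the pole at 0.\<close>
  have "continuous_on {k..k+1} (Gamma :: real \<Rightarrow> real)"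
    using assms by (intro continuous_intros) (auto elim!: nonpos_Ints_cases)
  then have "bounded ((Gamma :: real \<Rightarrow> real) ` {k..k+1})"
    by (intro compact_imp_bounded compact_continuous_image) auto
  then obtain C where C: "C > 0" "\<And>x. x \<in> {k..k+1} \<Longrightarrow> \<bar>Gamma x\<bar> \<le> C"
    unfolding bounded_pos by auto
  \<comment> \<open>The total exponential rate in the imaginary part: pi from the sine and pi/2 from
    the term \<open>\<i> * pi / 2\<close> in the exponent.\<close>
  define c where "c = 3 / 2 * pi"
  \<comment> \<open>\<open>C / \<delta>\<close> bounds \<open>Gamma (s + 1) / s\<close>; in the
    exponent, the first summand comes from \<open>x\<^sup>2 \<le> 1\<close> and the second from
    completing a square.\<close>
  define K where "K = C / \<delta> * exp (\<sigma>\<^sup>2 / 2 + c\<^sup>2 / \<sigma>\<^sup>2)"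
  show thesis
  proof (rule that)
    show "0 < K" using C assms by (simp add: K_def)
    fix t s assume t: "(t::real) > 0" and s: "Re s \<in> {k - 1..k}" "\<delta> \<le> norm s"
    define x y where "x = Re s" and "y = Im s"
    let ?E = "- (of_real (ln t) + \<i> * of_real pi / 2) * s + of_real (\<sigma>\<^sup>2) / 2 * s\<^sup>2"
    have nz: "s \<noteq> 0" using s assms by auto
    have "norm (Gamma (s + 1)) \<le> Gamma (x + 1)"
      using norm_Gamma_le_Gamma_Re[of "s + 1"] s assms by (simp add: x_def)
    also have "\<dots> \<le> C" using C(2)[of "x + 1"] s by (simp add: x_def)
    finally have G: "norm (Gamma (s + 1)) \<le> C" .
    have S: "norm (sin (of_real pi * s)) \<le> exp (pi * \<bar>y\<bar>)"
      using cmod_sin_le_exp[of 1 "of_real pi * s"] by (simp add: y_def abs_mult)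
    have "norm (of_real pi * rGamma (1 - s)) \<le> exp (pi * \<bar>y\<bar>) * C / \<delta>"
      using G S s assms C
      by (subst pi_rGamma_one_minus_eq) (auto simp: norm_divide norm_mult nz intro!: frac_le mult_mono)
    moreover have "norm (exp ?E) = t powr (- x) * exp (pi * y / 2 + \<sigma>\<^sup>2 * (x\<^sup>2 - y\<^sup>2) / 2)"
      using t by (simp add: powr_def x_def y_def power2_eq_square algebra_simps flip: exp_add)
    ultimately have "norm (entire_integrand \<sigma> t s) \<le>
        exp (pi * \<bar>y\<bar>) * C / \<delta> * (t powr (- x) * exp (pi * y / 2 + \<sigma>\<^sup>2 * (x\<^sup>2 - y\<^sup>2) / 2))"
      unfolding entire_integrand_def norm_mult[of _ "exp ?E"]
      by (metis mult_right_mono norm_ge_zero)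
    also have "\<dots> = C / \<delta> * t powr (- x) * exp (pi * \<bar>y\<bar> + pi * y / 2 + \<sigma>\<^sup>2 * (x\<^sup>2 - y\<^sup>2) / 2)"
      by (simp add: exp_add)
    also have "\<dots> \<le> C / \<delta> * t powr (- x) * exp (\<sigma>\<^sup>2 / 2 + c\<^sup>2 / \<sigma>\<^sup>2 + (- (\<sigma> * y)\<^sup>2 / 4))"
    proof -
      have eqs: "c * \<bar>y\<bar> = pi * \<bar>y\<bar> + pi * \<bar>y\<bar> / 2"
        "\<sigma>\<^sup>2 * (x\<^sup>2 - y\<^sup>2) / 2 = \<sigma>\<^sup>2 * x\<^sup>2 / 2 - (\<sigma> * y)\<^sup>2 / 2"
        by (simp_all add: c_def power_mult_distrib field_simps)
      have "\<bar>x\<bar> \<le> 1" using s assms by (auto simp: x_def)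
      then have "x\<^sup>2 \<le> 1" by (simp add: abs_square_le_1)
      then have "\<sigma>\<^sup>2 * x\<^sup>2 \<le> \<sigma>\<^sup>2" by (simp add: mult_left_le)
      moreover have "pi * y \<le> pi * \<bar>y\<bar>" by simp
      \<comment> \<open>Half of the available decay \<open>(\<sigma> * y)\<^sup>2 / 2\<close> is
        spent on absorbing \<open>c * \<bar>y\<bar>\<close>, which leaves the 4 in the final
        exponent.\<close>
      moreover have "0 \<le> (\<sigma> * \<bar>y\<bar> / 2 - c / \<sigma>)\<^sup>2" by simp
      then have "c * \<bar>y\<bar> \<le> (\<sigma> * y)\<^sup>2 / 4 + c\<^sup>2 / \<sigma>\<^sup>2"
        using assms by (simp add: power2_diff power_mult_distrib power_divide mult.commute)
      ultimately have "pi * \<bar>y\<bar> + pi * y / 2 + \<sigma>\<^sup>2 * (x\<^sup>2 - y\<^sup>2) / 2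
          \<le> \<sigma>\<^sup>2 / 2 + c\<^sup>2 / \<sigma>\<^sup>2 + (- (\<sigma> * y)\<^sup>2 / 4)"
        using eqs by linarith
      then show ?thesis using C assms by (intro mult_left_mono) auto
    qed
    also have "\<dots> = K * t powr (- x) * exp (- (\<sigma> * y)\<^sup>2 / 4)"
      by (simp only: K_def exp_add mult_ac)
    finally show "norm (entire_integrand \<sigma> t s) \<le> K * t powr (- Re s) * exp (- (\<sigma> * Im s)\<^sup>2 / 4)"
      by (simp add: x_def y_def)
  qed
qed

section \<open>Integrability and size of the claimed integral\<close>

lemma integrable_gaussian:
  assumes "(\<sigma>::real) > 0"
  shows "integrable lborel (\<lambda>y. exp (- (\<sigma> * y)\<^sup>2 / 4))"
proof -
  \<comment> \<open>Variance \<open>2 / \<sigma>\<^sup>2\<close> gives the desired exponent, and the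
    prefactor cancels the normalization.\<close>
  have "integrable lborel (\<lambda>y. sqrt (2 * pi * (sqrt 2 / \<sigma>)\<^sup>2) * normal_density 0 (sqrt 2 / \<sigma>) y)"
    using assms by (intro integrable_mult_right integrable_normal_density) auto
  also have "(\<lambda>y. sqrt (2 * pi * (sqrt 2 / \<sigma>)\<^sup>2) * normal_density 0 (sqrt 2 / \<sigma>) y) =
      (\<lambda>y. exp (- (\<sigma> * y)\<^sup>2 / 4))"
    using assms by (auto simp: normal_density_def power_divide power_mult_distrib field_simps)
  finally show ?thesis .
qed

text \<open>The power of \<open>t\<close> is read off on the line \<open>Re s = k - 1\<close>, where
  \<open>t powr (- Re s)\<close> is \<open>t powr (1 - k)\<close>; \<open>B\<close> does not depend
  on \<open>t\<close>. Integrability ensures that the integral is not a default value.\<close>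

lemma vertical_line_integrable_claimed_and_bound:
  assumes "\<sigma> > 0" "0 < k" "k < 1"
  obtains B where
    "\<And>t. t > 0 \<Longrightarrow> vertical_line_integrable k (claimed_integrand \<sigma> t)"
    "\<And>t. t > 0 \<Longrightarrow> norm (vertical_line_integral k (claimed_integrand \<sigma> t)) \<le> B * t powr (1 - k)"
proof -
  define g where "g y = exp (- (\<sigma> * y)\<^sup>2 / 4)" for y
  have g: "integrable lborel g"
    unfolding g_def using assms by (intro integrable_gaussian)
  \<comment> \<open>The distance from 0 to the nearer of the two lines. Being less than 1, it also
    admits every point with \<open>1 \<le> \<bar>Im s\<bar>\<close>.\<close>
  define \<delta> where "\<delta> = min k (1 - k)"
  obtain K where "0 < K" and K: "\<And>t s. t > 0 \<Longrightarrow> Re s \<in> {k - 1..k} \<Longrightarrow> \<delta> \<le> norm s \<Longrightarrow>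
       norm (entire_integrand \<sigma> t s) \<le> K * t powr (- Re s) * g (Im s)"
    unfolding g_def using norm_entire_integrand_le[of \<sigma> k \<delta>] assms by (auto simp: \<delta>_def)
  have line: "norm (entire_integrand \<sigma> t (Complex x y)) \<le> K * t powr (- x) * g y"
    if "t > 0" "x = k \<or> x = k - 1" for t x y
    using K[of t "Complex x y"] abs_Re_le_cmod[of "Complex x y"] that assms by (auto simp: \<delta>_def)
  have int: "vertical_line_integrable x (entire_integrand \<sigma> t)"
    if "t > 0" "x = k \<or> x = k - 1" for t x
    unfolding vertical_line_integrable_def
  proof (rule Bochner_Integration.integrable_bound)
    show "integrable lborel (\<lambda>y. K * t powr (- x) * g y)"
      using g by simp
    have "continuous_on UNIV (\<lambda>y. entire_integrand \<sigma> t (Complex x y))"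
      unfolding Complex_eq
      by (intro continuous_on_compose2[OF holomorphic_on_imp_continuous_on
            [OF holomorphic_entire_integrand[of \<sigma> t UNIV]]] continuous_intros) auto
    then show "(\<lambda>y. entire_integrand \<sigma> t (Complex x y)) \<in> borel_measurable lborel"
      by (simp add: borel_measurable_continuous_onI)
    show "AE y in lborel. norm (entire_integrand \<sigma> t (Complex x y)) \<le> norm (K * t powr (- x) * g y)"
      using line[OF that] by (intro AE_I2) (use order_trans abs_ge_self in fastforce)
  qed
  have claimed: "claimed_integrand \<sigma> t (Complex k y) = entire_integrand \<sigma> t (Complex k y)" for t y
    using assms by (intro claimed_integrand_eq_entire_integrand) auto
  have shift: "vertical_line_integral (k - 1) (entire_integrand \<sigma> t) =
      vertical_line_integral k (entire_integrand \<sigma> t)" if t: "t > 0" for t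
  proof -
    \<comment> \<open>Here \<open>t\<close> is fixed: \<open>C\<close> may depend on it, because it
      serves only to make the horizontal edges vanish.\<close>
    have "continuous_on {k - 1..k} (\<lambda>x. t powr (- x))"
      using t by (intro continuous_intros) auto
    then have "bounded ((\<lambda>x. t powr (- x)) ` {k - 1..k})"
      by (intro compact_imp_bounded compact_continuous_image) auto
    then obtain C where C: "C > 0" "\<And>x. x \<in> {k - 1..k} \<Longrightarrow> t powr (- x) \<le> C"
      unfolding bounded_pos by auto
    have bound: "norm (entire_integrand \<sigma> t (Complex x y)) \<le> K * C * g \<bar>y\<bar>"
      if "x \<in> {k - 1..k}" "1 \<le> \<bar>y\<bar>" for x y
    proof -
      have "\<delta> \<le> norm (Complex x y)"
        using abs_Im_le_cmod[of "Complex x y"] that assms by (auto simp: \<delta>_def)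
      then have "norm (entire_integrand \<sigma> t (Complex x y)) \<le> K * t powr (- x) * g y"
        using K[of t "Complex x y"] t that by simp
      also have "\<dots> \<le> K * C * g y"
        using C(2)[of x] that \<open>0 < K\<close> by (intro mult_right_mono mult_left_mono) (auto simp: g_def)
      also have "g y = g \<bar>y\<bar>" by (simp add: g_def power_mult_distrib)
      finally show ?thesis .
    qed
    have "(g \<longlongrightarrow> 0) at_top"
      unfolding g_def using assms by real_asymp
    then have "((\<lambda>y. K * C * g y) \<longlongrightarrow> 0) at_top"
      by (intro tendsto_mult_right_zero)
    then show ?thesis
      using bound int[OF t] holomorphic_entire_integrand
      by (intro vertical_line_integral_shift[where h = "\<lambda>y. K * C * g y"]) auto
  qed
  show thesis
  proof (rule that)
    fix t :: real assume t: "t > 0"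
    show "vertical_line_integrable k (claimed_integrand \<sigma> t)"
      using int[OF t, of k] by (simp add: vertical_line_integrable_def claimed)
    have "vertical_line_integral k (claimed_integrand \<sigma> t) =
        vertical_line_integral (k - 1) (entire_integrand \<sigma> t)"
      using shift[OF t] by (simp add: vertical_line_integral_def claimed)
    also have "norm \<dots> \<le> (LINT y|lborel. K * t powr (- (k - 1)) * g y)"
      unfolding vertical_line_integral_def
      using int[OF t, of "k - 1"] g line[OF t, of "k - 1"]
      by (intro order_trans[OF integral_norm_bound] integral_mono)
        (auto simp: vertical_line_integrable_def norm_mult)
    also have "\<dots> = (K * (LINT y|lborel. g y)) * t powr (1 - k)"
      by simp
    finally show "norm (vertical_line_integral k (claimed_integrand \<sigma> t))
        \<le> (K * (LINT y|lborel. g y)) * t powr (1 - k)" .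
  qed
qed

section \<open>Comparing both sides as t tends to 0 from the right\<close>

theorem mainTheorem4:
  fixes M :: "'a measure" and X :: "'a \<Rightarrow> real" and \<sigma> k :: real
  assumes "prob_space M"
    and "\<sigma> > 0" and "0 < k" and "k < 1"
    and "distributed M lborel X (\<lambda>x. ennreal (lognormal_density \<sigma> x))"
  shows "\<exists>t::real. t > 0 \<and> vertical_line_integrable k (claimed_integrand \<sigma> t) \<and>
    char (distr M borel X) t \<noteq>
      1 / (2 * of_real pi) * vertical_line_integral k (claimed_integrand \<sigma> t)"
proof (rule ccontr)
  assume contra: "\<not> ?thesis"
  obtain B where int: "\<And>t. t > 0 \<Longrightarrow> vertical_line_integrable k (claimed_integrand \<sigma> t)"
    and B: "\<And>t. t > 0 \<Longrightarrow>
      norm (vertical_line_integral k (claimed_integrand \<sigma> t)) \<le> B * t powr (1 - k)"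
    using vertical_line_integrable_claimed_and_bound[OF assms(2-4)] by metis
  interpret prob_space M by fact
  have "random_variable borel X"
    using distributed_measurable[OF assms(5)] by simp
  then interpret D: real_distribution "distr M borel X"
    by (rule real_distribution_distr)
  let ?\<phi> = "char (distr M borel X)"
  have "(?\<phi> \<longlongrightarrow> 0) (at_right 0)"
  proof (rule Lim_null_comparison)
    show "eventually (\<lambda>t. norm (?\<phi> t) \<le> B * t powr (1 - k) / (2 * pi)) (at_right 0)"
      using eventually_at_right_less[of 0]
    proof eventually_elim
      case (elim t)
      \<comment> \<open>The negated goal yields the formula only where the integral converges
        absolutely, which \<open>int\<close> supplies.\<close>
      then have "?\<phi> t = 1 / (2 * of_real pi) * vertical_line_integral k (claimed_integrand \<sigma> t)"
        using contra int by blast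
      then have "norm (?\<phi> t) = norm (vertical_line_integral k (claimed_integrand \<sigma> t)) / (2 * pi)"
        by (simp add: norm_mult norm_divide)
      then show ?case using B[OF elim] by (simp add: divide_right_mono)
    qed
    show "((\<lambda>t. B * t powr (1 - k) / (2 * pi)) \<longlongrightarrow> 0) (at_right 0)"
      using \<open>k < 1\<close> by real_asymp
  qed
  moreover have "(?\<phi> \<longlongrightarrow> 1) (at_right 0)"
    using D.isCont_char[of 0] by (auto simp: isCont_def D.char_zero intro: tendsto_within_subset)
  ultimately show False
    using tendsto_unique[OF trivial_limit_at_right_real] zero_neq_one by metis
qed

end
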